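(* Let $G$ be a graph and let $\varepsilon$ be an end of $G$ with $\deg(\varepsilon)=\aleph_1$. Then $\varepsilon$ has property $HC^*(\aleph_1)$.
   Context: A ray is a one-way infinite path; two rays are equivalent if no finite vertex set separates them; ends are the equivalence classes. $\deg(\varepsilon)$ is the supremum of sizes of families of pairwise disjoint rays in $\varepsilon$. A family of paths is independent if the paths meet only in endpoints. For a family $\mathcal R$ of rays, an $\mathcal R$-family of paths has all endpoints on rays of $\mathcal R$; it is $\mathcal R$-internally disjoint if no path meets a ray of $\mathcal R$ except at its endpoints. The ray graph of $(\mathcal R,\mathcal P)$ (for pairwise disjoint equivalent rays $\mathcal R$ and independent $\mathcal P$) has vertex set $\mathcal R$, with $r,s$ adjacent iff infinitely many paths of $\mathcal P$ join $r$ and $s$. An end $\varepsilon$ of degree $\kappa$ has property $HC^*(\kappa)$ if there is a family $\mathcal R\subseteq\varepsilon$ of $\kappa$ pairwise disjoint rays and an $\mathcal R$-internally disjoint $\mathcal R$-family of paths $\mathcal P$ such that for every countable $\mathcal R'\subseteq\mathcal R$ there are a countable $\mathcal R''$ with $\mathcal R'\subseteq\mathcal R''\subseteq\mathcal R$ and a countable family $\mathcal P''\subseteq\mathcal P$ of independent $\mathcal R''$-paths such that the ray graph of $(\mathcal R'',\mathcal P'')$ is connected. *)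

theory Defs
  imports Main "HOL-Library.Countable_Set"
begin

definition graph :: "'a set \<Rightarrow> ('a \<Rightarrow> 'a \<Rightarrow> bool) \<Rightarrow> bool" where
  "graph V E \<longleftrightarrow> (\<forall>x y. E x y \<longrightarrow> x \<in> V \<and> y \<in> V \<and> E y x \<and> x \<noteq> y)"

definition is_ray :: "'a set \<Rightarrow> ('a \<Rightarrow> 'a \<Rightarrow> bool) \<Rightarrow> (nat \<Rightarrow> 'a) \<Rightarrow> bool" where
  "is_ray V E r \<longleftrightarrow> inj r \<and> range r \<subseteq> V \<and> (\<forall>n. E (r n) (r (Suc n)))"

definition is_path :: "'a set \<Rightarrow> ('a \<Rightarrow> 'a \<Rightarrow> bool) \<Rightarrow> 'a list \<Rightarrow> bool" where
  "is_path V E p \<longleftrightarrow> p \<noteq> [] \<and> distinct p \<and> set p \<subseteq> V \<and>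
     (\<forall>i. Suc i < length p \<longrightarrow> E (p ! i) (p ! Suc i))"

definition endpoints :: "'a list \<Rightarrow> 'a set" where
  "endpoints p = {hd p, last p}"

definition separates :: "'a set \<Rightarrow> ('a \<Rightarrow> 'a \<Rightarrow> bool) \<Rightarrow> 'a set \<Rightarrow> (nat \<Rightarrow> 'a) \<Rightarrow> (nat \<Rightarrow> 'a) \<Rightarrow> bool" where
  "separates V E S r s \<longleftrightarrow>
     (\<forall>p. is_path V E p \<and> hd p \<in> range r \<and> last p \<in> range s \<longrightarrow> set p \<inter> S \<noteq> {})"

definition equiv_rays :: "'a set \<Rightarrow> ('a \<Rightarrow> 'a \<Rightarrow> bool) \<Rightarrow> (nat \<Rightarrow> 'a) \<Rightarrow> (nat \<Rightarrow> 'a) \<Rightarrow> bool" where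
  "equiv_rays V E r s \<longleftrightarrow> is_ray V E r \<and> is_ray V E s \<and>
     \<not> (\<exists>S. finite S \<and> separates V E S r s)"

definition is_end :: "'a set \<Rightarrow> ('a \<Rightarrow> 'a \<Rightarrow> bool) \<Rightarrow> (nat \<Rightarrow> 'a) set \<Rightarrow> bool" where
  "is_end V E \<epsilon> \<longleftrightarrow> (\<exists>r. is_ray V E r \<and> \<epsilon> = {s. equiv_rays V E r s})"

definition disjoint_rays :: "'a set \<Rightarrow> ('a \<Rightarrow> 'a \<Rightarrow> bool) \<Rightarrow> (nat \<Rightarrow> 'a) set \<Rightarrow> bool" where
  "disjoint_rays V E \<R> \<longleftrightarrow> (\<forall>r\<in>\<R>. is_ray V E r) \<and>
     (\<forall>r\<in>\<R>. \<forall>s\<in>\<R>. r \<noteq> s \<longrightarrow> range r \<inter> range s = {})"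

definition degree_le :: "'a set \<Rightarrow> ('a \<Rightarrow> 'a \<Rightarrow> bool) \<Rightarrow> (nat \<Rightarrow> 'a) set \<Rightarrow> 'b rel \<Rightarrow> bool" where
  "degree_le V E \<epsilon> \<kappa> \<longleftrightarrow> (\<forall>\<R>. \<R> \<subseteq> \<epsilon> \<and> disjoint_rays V E \<R> \<longrightarrow> (card_of \<R>, \<kappa>) \<in> ordLeq)"

abbreviation aleph1 :: "nat set rel" where
  "aleph1 \<equiv> cardSuc natLeq"

text \<open>deg(\<epsilon>) = aleph_1: the supremum of the sizes of disjoint ray families in \<epsilon>
 is aleph_1, i.e. aleph_1 is an upper bound and no smaller cardinal
 (= no cardinal \<le> aleph_0) is an upper bound.\<close>
definition degree_aleph1 :: "'a set \<Rightarrow> ('a \<Rightarrow> 'a \<Rightarrow> bool) \<Rightarrow> (nat \<Rightarrow> 'a) set \<Rightarrow> bool" where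
  "degree_aleph1 V E \<epsilon> \<longleftrightarrow> degree_le V E \<epsilon> aleph1 \<and> \<not> degree_le V E \<epsilon> natLeq"

definition independent :: "'a list set \<Rightarrow> bool" where
  "independent P \<longleftrightarrow> (\<forall>p\<in>P. \<forall>q\<in>P. p \<noteq> q \<longrightarrow> set p \<inter> set q \<subseteq> endpoints p \<inter> endpoints q)"

definition R_family :: "'a set \<Rightarrow> ('a \<Rightarrow> 'a \<Rightarrow> bool) \<Rightarrow> (nat \<Rightarrow> 'a) set \<Rightarrow> 'a list set \<Rightarrow> bool" where
  "R_family V E \<R> P \<longleftrightarrow> (\<forall>p\<in>P. is_path V E p \<and>
     (\<exists>r\<in>\<R>. hd p \<in> range r) \<and> (\<exists>r\<in>\<R>. last p \<in> range r))"

definition R_internally_disjoint :: "(nat \<Rightarrow> 'a) set \<Rightarrow> 'a list set \<Rightarrow> bool" where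
  "R_internally_disjoint \<R> P \<longleftrightarrow> (\<forall>p\<in>P. \<forall>r\<in>\<R>. set p \<inter> range r \<subseteq> endpoints p)"

definition joins :: "'a list \<Rightarrow> (nat \<Rightarrow> 'a) \<Rightarrow> (nat \<Rightarrow> 'a) \<Rightarrow> bool" where
  "joins p r s \<longleftrightarrow> (hd p \<in> range r \<and> last p \<in> range s) \<or> (hd p \<in> range s \<and> last p \<in> range r)"

definition ray_graph_adj :: "(nat \<Rightarrow> 'a) set \<Rightarrow> 'a list set \<Rightarrow> (nat \<Rightarrow> 'a) \<Rightarrow> (nat \<Rightarrow> 'a) \<Rightarrow> bool" where
  "ray_graph_adj \<R> P r s \<longleftrightarrow> r \<in> \<R> \<and> s \<in> \<R> \<and> r \<noteq> s \<and> infinite {p\<in>P. joins p r s}"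

definition ray_graph_connected :: "(nat \<Rightarrow> 'a) set \<Rightarrow> 'a list set \<Rightarrow> bool" where
  "ray_graph_connected \<R> P \<longleftrightarrow> (\<forall>r\<in>\<R>. \<forall>s\<in>\<R>. (ray_graph_adj \<R> P)\<^sup>*\<^sup>* r s)"

definition HC_star_aleph1 :: "'a set \<Rightarrow> ('a \<Rightarrow> 'a \<Rightarrow> bool) \<Rightarrow> (nat \<Rightarrow> 'a) set \<Rightarrow> bool" where
  "HC_star_aleph1 V E \<epsilon> \<longleftrightarrow>
    (\<exists>\<R> P. \<R> \<subseteq> \<epsilon> \<and> disjoint_rays V E \<R> \<and> (card_of \<R>, aleph1) \<in> ordIso \<and>
       R_family V E \<R> P \<and> R_internally_disjoint \<R> P \<and>
       (\<forall>\<R>'. \<R>' \<subseteq> \<R> \<and> countable \<R>' \<longrightarrow>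
          (\<exists>\<R>'' P''. \<R>' \<subseteq> \<R>'' \<and> \<R>'' \<subseteq> \<R> \<and> countable \<R>'' \<and>
             P'' \<subseteq> P \<and> countable P'' \<and> independent P'' \<and> R_family V E \<R>'' P'' \<and>
             ray_graph_connected \<R>'' P'')))"

end

theory Submission
  imports Defs "HOL-Library.Countable_Set_Type"
begin

text \<open>Call \<open>a\<close> and \<open>u\<close> uncountably linked if no countable vertex set separates them. Closing a ray
  of the end under countable separators shows that some vertex \<open>u\<close> is adjacent, outside every
  countable set, to the component of a ray of the end. Fix a ray \<open>r\<close> of the end through \<open>u\<close>. Outside any
  countable set there is a ray \<open>q\<close> of the end with infinitely many paths to \<open>r\<close> that are disjoint
  off \<open>q\<close> and \<open>r\<close> and meet the countable set only in a fixed countable \<open>Z0\<close>. Either \<open>q\<close> can be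
  chosen to contain a vertex \<open>v\<close> uncountably linked to \<open>u\<close>, and the paths run from \<open>v\<close> to \<open>u\<close>; or all
  points of attachment of \<open>q\<close> lie in \<open>Z0\<close>, and each of them is on \<open>r\<close> or uncountably linked to \<open>u\<close>.
  A maximal family of such fans that do not interfere is uncountable. The paths of different fans may
  meet each other, but countably many fans can be thinned out to an independent family, whose ray
  graph is a star with centre \<open>r\<close>.\<close>

section \<open>Countable closures and selection of path families\<close>

text \<open>Serves for choosing \<open>f x\<close> as a countable set witnessing that some property
  fails at \<open>x\<close>: one countable set then contains the witnesses of all its own
  members.\<close>

lemma countable_closure:
  assumes "\<And>x. countable (f x)" "countable Z"
  obtains X where "countable X" "Z \<subseteq> X" "\<And>x. x \<in> X \<Longrightarrow> f x \<subseteq> X"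
proof
  define X where "X = (\<Union>n. ((\<lambda>A. A \<union> \<Union>(f ` A)) ^^ n) Z)"
  have "countable (((\<lambda>A. A \<union> \<Union>(f ` A)) ^^ n) Z)" for n
    by (induction n) (use assms in auto)
  then show "countable X"
    unfolding X_def by blast
  show "Z \<subseteq> X"
    unfolding X_def by (rule UN_upper[of 0, THEN subset_trans[rotated]]) auto
  show "f x \<subseteq> X" if "x \<in> X" for x
  proof -
    from that obtain n where "x \<in> ((\<lambda>A. A \<union> \<Union>(f ` A)) ^^ n) Z"
      unfolding X_def by blast
    then have "f x \<subseteq> ((\<lambda>A. A \<union> \<Union>(f ` A)) ^^ Suc n) Z"
      by auto
    then show ?thesis
      unfolding X_def by blast
  qed
qed

text \<open>Every member of \<open>\<P>\<close> is visited infinitely often; each time only finitely many paths are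
  blocked by the finitely many vertices used so far.\<close>
lemma infinite_subfamilies_disjoint_outside:
  assumes "countable \<P>" and inf: "\<And>P. P \<in> \<P> \<Longrightarrow> infinite P"
    and fin: "\<And>P x. P \<in> \<P> \<Longrightarrow> x \<notin> B \<Longrightarrow> finite {p \<in> P. x \<in> set p}"
  shows "\<exists>Q. Q \<subseteq> \<Union>\<P> \<and> countable Q \<and> (\<forall>P\<in>\<P>. infinite (P \<inter> Q)) \<and>
    (\<forall>p\<in>Q. \<forall>p'\<in>Q. p \<noteq> p' \<longrightarrow> set p \<inter> set p' \<subseteq> B)"
proof (cases "\<P> = {}")
  case True
  then show ?thesis
    by (intro exI[of _ "{}"]) simp
next
  case False
  \<comment> \<open>The first component of the decoded pair names the member of \<open>\<P>\<close>
    served at stage \<open>n\<close>; the free second component makes each member recur infinitely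
    often.\<close>
  define f where "f n = from_nat_into \<P> (fst (prod_decode n))" for n
  have f: "f n \<in> \<P>" for n
    unfolding f_def using False by (simp add: from_nat_into)
  have "\<exists>g. \<forall>n. g n \<in> f n \<and> g n \<notin> g ` {..<n} \<and> (\<forall>i<n. set (g n) \<inter> set (g i) \<subseteq> B)"
  proof (rule dependent_wellorder_choice)
    fix n :: nat and g :: "nat \<Rightarrow> 'a list"
    let ?bad = "g ` {..<n} \<union> (\<Union>x \<in> (\<Union>i<n. set (g i)) - B. {p \<in> f n. x \<in> set p})"
    have "finite ?bad"
      using fin[OF f] by auto
    then have "infinite (f n - ?bad)"
      using inf[OF f] by (rule Diff_infinite_finite)
    then obtain p where "p \<in> f n - ?bad"
      using infinite_imp_nonempty by blast
    then show "\<exists>p. p \<in> f n \<and> p \<notin> g ` {..<n} \<and> (\<forall>i<n. set p \<inter> set (g i) \<subseteq> B)"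
      by (intro exI[of _ p]) auto
  qed (auto simp: image_def)
  then obtain g where g: "\<And>n. g n \<in> f n" "\<And>n. g n \<notin> g ` {..<n}"
    "\<And>n i. i < n \<Longrightarrow> set (g n) \<inter> set (g i) \<subseteq> B"
    by blast
  have neq: "g i \<noteq> g j" if "i < j" for i j
  proof -
    have "g i \<in> g ` {..<j}"
      using that by simp
    with g(2)[of j] show ?thesis
      by metis
  qed
  have "inj g"
    by (rule linorder_injI) (rule neq)
  show ?thesis
  proof (intro exI[of _ "range g"] conjI ballI impI)
    show "range g \<subseteq> \<Union>\<P>"
      using g(1) f by (intro image_subsetI UnionI)
    show "infinite (P \<inter> range g)" if P: "P \<in> \<P>" for P
    proof -
      obtain k where k: "from_nat_into \<P> k = P"
        using from_nat_into_surj[OF \<open>countable \<P>\<close> P] by (elim exE)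
      have "inj (\<lambda>m. g (prod_encode (k, m)))"
        by (rule injI) (use \<open>inj g\<close> in \<open>simp add: inj_eq\<close>)
      then have "infinite (range (\<lambda>m. g (prod_encode (k, m))))"
        by (rule range_inj_infinite)
      moreover have "g (prod_encode (k, m)) \<in> P \<inter> range g" for m
        using g(1)[of "prod_encode (k, m)"] k by (simp add: f_def)
      then have "range (\<lambda>m. g (prod_encode (k, m))) \<subseteq> P \<inter> range g"
        by (rule image_subsetI)
      ultimately show ?thesis
        by (rule infinite_super[rotated])
    qed
    show "set p \<inter> set p' \<subseteq> B" if p: "p \<in> range g" "p' \<in> range g" "p \<noteq> p'" for p p'
    proof -
      obtain i j where ij: "p = g i" "p' = g j"
        using p(1,2) by blast
      have "i \<noteq> j"
        using p(3) unfolding ij by (rule contrapos_nn) simp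
      then have "set (g i) \<inter> set (g j) \<subseteq> B"
        using g(3)[of i j] g(3)[of j i] by (cases "i < j") (simp_all add: Int_commute)
      then show ?thesis
        unfolding ij .
    qed
    show "countable (range g)"
      by simp
  qed
qed

text \<open>Paths are chosen one after another, with \<open>S\<close> the set of vertices used so
  far. An overlap may lie entirely in \<open>B\<close>, so the condition that \<open>p\<close>
  leaves \<open>S\<close> is what makes each new path differ from the earlier ones.\<close>

lemma infinite_family_disjoint_outside:
  assumes ex: "\<And>S. finite S \<Longrightarrow> \<exists>p. good p \<and> set p \<inter> S \<subseteq> B \<and> \<not> set p \<subseteq> S"
  obtains P where "infinite P" "countable P" "\<And>p. p \<in> P \<Longrightarrow> good p"
    "\<And>x. x \<notin> B \<Longrightarrow> finite {p \<in> P. x \<in> set p}"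
proof -
  have "\<exists>g. \<forall>n::nat. good (g n) \<and> set (g n) \<inter> (\<Union>i<n. set (g i)) \<subseteq> B \<and> \<not> set (g n) \<subseteq> (\<Union>i<n. set (g i))"
  proof (rule dependent_wellorder_choice)
    show "\<exists>p. good p \<and> set p \<inter> (\<Union>i<n. set (g i)) \<subseteq> B \<and> \<not> set p \<subseteq> (\<Union>i<n. set (g i))"
      for n :: nat and g :: "nat \<Rightarrow> 'a list"
      by (rule ex) auto
  qed auto
  then obtain g where "\<forall>n::nat. good (g n) \<and> set (g n) \<inter> (\<Union>i<n. set (g i)) \<subseteq> B \<and>
      \<not> set (g n) \<subseteq> (\<Union>i<n. set (g i))" ..
  then have g: "good (g n)" "set (g n) \<inter> (\<Union>i<n. set (g i)) \<subseteq> B"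
      "\<not> set (g n) \<subseteq> (\<Union>i<n. set (g i))" for n
    by simp_all
  have neq: "g i \<noteq> g j" if "i < j" for i j
    using g(3)[of j] that by auto
  have "inj g"
    by (rule linorder_injI) (rule neq)
  show ?thesis
  proof (rule that[of "range g"])
    show "infinite (range g)"
      using \<open>inj g\<close> by (rule range_inj_infinite)
    show "finite {p \<in> range g. x \<in> set p}" if "x \<notin> B" for x
    proof -
      have "i = j" if "x \<in> set (g i)" "x \<in> set (g j)" for i j
        using that \<open>x \<notin> B\<close> g(2)[of i] g(2)[of j] by (cases i j rule: linorder_cases) auto
      then have "\<exists>i. {p \<in> range g. x \<in> set p} \<subseteq> {g i}"
        by blast
      then show ?thesis
        using finite_subset by blast
    qed
  qed (use g in auto)
qed

section \<open>Finite paths\<close>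

lemma is_path_iff:
  "is_path V E p \<longleftrightarrow> p \<noteq> [] \<and> distinct p \<and> set p \<subseteq> V \<and> successively E p"
  unfolding is_path_def successively_conv_nth by simp

lemma is_path_append:
  "is_path V E p \<Longrightarrow> is_path V E q \<Longrightarrow> E (last p) (hd q) \<Longrightarrow> set p \<inter> set q = {} \<Longrightarrow> is_path V E (p @ q)"
  by (auto simp: is_path_iff successively_append_iff)

lemma is_path_appendD:
  assumes "is_path V E (p @ q)"
  shows "p \<noteq> [] \<Longrightarrow> is_path V E p" and "q \<noteq> [] \<Longrightarrow> is_path V E q"
  using assms by (auto simp: is_path_iff successively_append_iff)

lemma is_path_rev:
  assumes "graph V E" "is_path V E p"
  shows "is_path V E (rev p)"
proof -
  have "successively (\<lambda>x y. E y x) p"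
    using assms successively_mono[of E p "\<lambda>x y. E y x"] unfolding is_path_iff graph_def by blast
  then show ?thesis
    using assms(2) by (simp add: is_path_iff)
qed

text \<open>The two paths may cross, so plain concatenation can repeat vertices. Instead
  \<open>p\<close> is left for \<open>q\<close> at its first vertex on \<open>q\<close>.\<close>

lemma path_join:
  assumes p: "is_path V E p" and q: "is_path V E q" and eq: "last p = hd q"
  obtains s where "is_path V E s" "hd s = hd p" "last s = last q" "set s \<subseteq> set p \<union> set q"
proof -
  have "last p \<in> set p" "hd q \<in> set q"
    using p q by (simp_all add: is_path_iff)
  then have "\<exists>x\<in>set p. x \<in> set q"
    using eq by metis
  then obtain ys x zs where P: "p = ys @ x # zs" "x \<in> set q" "\<forall>y\<in>set ys. y \<notin> set q"
    using split_list_first_prop[of p "\<lambda>x. x \<in> set q"] by blast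
  obtain as bs where Q: "q = as @ x # bs"
    using P(2) split_list by fast
  show ?thesis
  proof (rule that[of "ys @ x # bs"])
    show "is_path V E (ys @ x # bs)"
      using p q P(3) unfolding P(1) Q
      by (auto simp: is_path_iff successively_append_iff)
    show "hd (ys @ x # bs) = hd p"
      unfolding P(1) by (cases ys) auto
  qed (auto simp: P(1) Q)
qed

text \<open>Stop \<open>p\<close> at its first vertex in \<open>B\<close>, then start at the last
  vertex of \<open>A\<close> on what remains. The result is a single vertex if these two
  coincide.\<close>

lemma path_prune:
  assumes p: "is_path V E p" "hd p \<in> A" "last p \<in> B"
  obtains s where "is_path V E s" "set s \<subseteq> set p" "set s \<inter> A = {hd s}" "set s \<inter> B = {last s}"
proof -
  have ne: "p \<noteq> []"
    using p by (simp add: is_path_iff)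
  obtain ys x zs where P: "p = ys @ x # zs" "x \<in> B" "\<forall>y\<in>set ys. y \<notin> B"
    using split_list_first_prop[of p "\<lambda>x. x \<in> B"] p(3) last_in_set[OF ne] by blast
  have path: "is_path V E (ys @ [x])"
    using is_path_appendD(1)[of V E "ys @ [x]" zs] p(1) P(1) by simp
  have "hd (ys @ [x]) \<in> A"
    using p(2) unfolding P(1) by (cases ys) auto
  then have "\<exists>y\<in>set (ys @ [x]). y \<in> A"
    using hd_in_set[of "ys @ [x]"] by blast
  then obtain as a bs where S: "ys @ [x] = as @ a # bs" "a \<in> A" "\<forall>y\<in>set bs. y \<notin> A"
    using split_list_last_prop[of "ys @ [x]" "\<lambda>x. x \<in> A"] by blast
  have "last (a # bs) = last (ys @ [x])"
    unfolding S(1) by simp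
  then have last: "last (a # bs) = x"
    by simp
  have sub: "set (a # bs) \<subseteq> insert x (set ys)"
    using arg_cong[OF S(1), of set] by auto
  show ?thesis
  proof (rule that[of "a # bs"])
    show "is_path V E (a # bs)"
      using is_path_appendD(2)[of V E as "a # bs"] path S(1) by simp
    show "set (a # bs) \<subseteq> set p"
      using sub unfolding P(1) by auto
    show "set (a # bs) \<inter> A = {hd (a # bs)}"
      using S by auto
    have "x \<in> set (a # bs)"
      using last last_in_set[of "a # bs"] by simp
    then show "set (a # bs) \<inter> B = {last (a # bs)}"
      unfolding last using sub P by blast
  qed
qed

lemma ray_segment:
  assumes "graph V E" "is_ray V E r"
  obtains p where "is_path V E p" "hd p = r i" "last p = r j" "set p \<subseteq> r ` {min i j..}"
proof -
  have seg: "is_path V E (map r [i..<Suc j])" "hd (map r [i..<Suc j]) = r i"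
    "last (map r [i..<Suc j]) = r j" "set (map r [i..<Suc j]) \<subseteq> r ` {i..}"
    if "i \<le> j" for i j
  proof -
    have "[i..<Suc j] \<noteq> []"
      using that by simp
    then show "hd (map r [i..<Suc j]) = r i" "last (map r [i..<Suc j]) = r j"
      using that by (simp_all add: hd_map last_map del: upt_Suc)
    show "set (map r [i..<Suc j]) \<subseteq> r ` {i..}"
      by auto
    show "is_path V E (map r [i..<Suc j])"
      using assms(2) that unfolding is_path_def is_ray_def
      by (auto simp: distinct_map inj_on_def inj_def simp del: upt_Suc)
  qed
  show ?thesis
  proof (cases "i \<le> j")
    case True
    then show ?thesis
      using seg[of i j] by (intro that[of "map r [i..<Suc j]"]) auto
  next
    case False
    then have "j \<le> i" by simp
    note s = seg[OF this]
    show ?thesis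
      by (rule that[of "rev (map r [j..<Suc i])"])
        (use s is_path_rev[OF assms(1) s(1)] \<open>j \<le> i\<close> in \<open>auto simp: hd_rev last_rev min_def simp del: upt_Suc\<close>)
  qed
qed

section \<open>Rays of an end\<close>

locale graph_end =
  fixes V :: "'a set" and E :: "'a \<Rightarrow> 'a \<Rightarrow> bool" and \<epsilon> :: "(nat \<Rightarrow> 'a) set"
  assumes graph: "graph V E" and is_end: "is_end V E \<epsilon>"
begin

lemma edge_sym: "E x y \<Longrightarrow> E y x"
  and edge_in_V: "E x y \<Longrightarrow> x \<in> V \<and> y \<in> V"
  using graph unfolding graph_def by blast+

lemma end_is_ray: "r \<in> \<epsilon> \<Longrightarrow> is_ray V E r"
  using is_end unfolding is_end_def equiv_rays_def by blast

text \<open>This is the relation of lying in the same component of the graph with \<open>Z\<close>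
  deleted.\<close>

definition link :: "'a set \<Rightarrow> 'a \<Rightarrow> 'a \<Rightarrow> bool" where
  "link Z x y \<longleftrightarrow> (\<exists>p. is_path V E p \<and> hd p = x \<and> last p = y \<and> set p \<inter> Z = {})"

lemma linkI: "is_path V E p \<Longrightarrow> set p \<inter> Z = {} \<Longrightarrow> link Z (hd p) (last p)"
  unfolding link_def by blast

lemma link_sym: "link Z x y \<Longrightarrow> link Z y x"
  unfolding link_def using is_path_rev[OF graph] by (metis hd_rev last_rev set_rev)

lemma link_trans:
  assumes "link Z x y" "link Z y z"
  shows "link Z x z"
proof -
  obtain p where p: "is_path V E p" "hd p = x" "last p = y" "set p \<inter> Z = {}"
    using assms(1) unfolding link_def by blast
  obtain q where q: "is_path V E q" "hd q = y" "last q = z" "set q \<inter> Z = {}"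
    using assms(2) unfolding link_def by blast
  obtain s where "is_path V E s" "hd s = hd p" "last s = last q" "set s \<subseteq> set p \<union> set q"
    using path_join[OF p(1) q(1)] p(3) q(2) by metis
  with p q show ?thesis
    unfolding link_def by (intro exI[of _ s]) blast
qed

lemma link_mono: "link Z x y \<Longrightarrow> Z' \<subseteq> Z \<Longrightarrow> link Z' x y"
  unfolding link_def by blast

lemma link_ray:
  assumes "is_ray V E r" "r ` {min i j..} \<inter> Z = {}"
  shows "link Z (r i) (r j)"
proof -
  obtain p where "is_path V E p" "hd p = r i" "last p = r j" "set p \<subseteq> r ` {min i j..}"
    using ray_segment[OF graph assms(1)] .
  with assms(2) show ?thesis
    unfolding link_def by (intro exI[of _ p]) blast
qed

lemma ray_eventually_avoids:
  assumes "is_ray V E r" "finite S"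
  obtains N where "r ` {N..} \<inter> S = {}"
proof -
  have "inj r"
    using assms(1) by (simp add: is_ray_def)
  then have "finite (r -` S)"
    using assms(2) by (simp add: finite_vimageI)
  then obtain N where N: "\<forall>n\<in>r -` S. n < N"
    using finite_nat_set_iff_bounded by blast
  then have "r n \<notin> S" if "n \<ge> N" for n
    using N that leD by (metis vimageI)
  then show ?thesis
    by (intro that[of N]) blast
qed

text \<open>Both rays are compared with the ray \<open>b\<close> that defines the end. Adding the
  first \<open>N\<close> vertices of \<open>b\<close> to the separator forces the connecting paths
  to start in a tail of \<open>b\<close> that avoids \<open>S\<close>, and this tail joins
  them.\<close>

lemma end_links:
  assumes "q \<in> \<epsilon>" "r \<in> \<epsilon>" "finite S"
  obtains x y where "x \<in> range q" "y \<in> range r" "link S x y"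
proof -
  obtain b where b: "is_ray V E b" "\<epsilon> = {s. equiv_rays V E b s}"
    using is_end unfolding is_end_def by blast
  obtain N where N: "b ` {N..} \<inter> S = {}"
    using ray_eventually_avoids[OF b(1) assms(3)] .
  have tail: "\<exists>i\<ge>N. \<exists>y\<in>range s. link S (b i) y" if "s \<in> \<epsilon>" for s
  proof -
    have "finite (S \<union> b ` {..<N})"
      using assms(3) by simp
    then have "\<not> separates V E (S \<union> b ` {..<N}) b s"
      using that unfolding b(2) equiv_rays_def mem_Collect_eq by metis
    then obtain p where p: "is_path V E p" "hd p \<in> range b" "last p \<in> range s"
      "set p \<inter> (S \<union> b ` {..<N}) = {}"
      unfolding separates_def by blast
    obtain i where i: "hd p = b i"
      using p(2) by blast
    have "hd p \<in> set p"
      using p(1) by (simp add: is_path_iff)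
    then have "\<not> i < N"
      using p(4) i by auto
    moreover have "link S (b i) (last p)"
      using linkI[OF p(1), of S] p(4) i by auto
    ultimately show ?thesis
      using p(3) by (intro exI[of _ i]) auto
  qed
  obtain i x where i: "i \<ge> N" "x \<in> range q" "link S (b i) x"
    using tail[OF assms(1)] by blast
  obtain j y where j: "j \<ge> N" "y \<in> range r" "link S (b j) y"
    using tail[OF assms(2)] by blast
  have "{min i j..} \<subseteq> {N..}"
    using i(1) j(1) by auto
  then have "link S (b i) (b j)"
    using N image_mono[of _ _ b] by (intro link_ray[OF b(1)]) (metis Int_mono order_refl subset_empty)
  then have "link S x y"
    using link_trans[OF link_trans[OF link_sym[OF i(3)]] j(3)] by simp
  with i(2) j(2) show ?thesis
    by (rule that)
qed

text \<open>The new ray follows \<open>p\<close> and then \<open>q\<close>. It shares a tail with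
  \<open>q\<close>, and finite sets cannot tell rays with a common tail apart.\<close>

lemma end_extend:
  assumes p: "is_path V E p" and q: "q \<in> \<epsilon>" and int: "set p \<inter> range q = {last p}"
  obtains q' where "q' \<in> \<epsilon>" "hd p \<in> range q'" "range q' \<subseteq> set p \<union> range q"
proof -
  obtain k where k: "last p = q k"
    using int by blast
  define l where "l = length p"
  \<comment> \<open>The vertex \<open>q k\<close> is already the last one of \<open>p\<close>, so
    the continuation starts at \<open>q (Suc k)\<close>.\<close>
  define q' where "q' n = (if n < l then p ! n else q (Suc k + (n - l)))" for n
  have rq: "inj q" "range q \<subseteq> V" "\<And>n. E (q n) (q (Suc n))"
    using end_is_ray[OF q] by (auto simp: is_ray_def)
  have ne: "p \<noteq> []" "distinct p" "set p \<subseteq> V" "\<And>i. Suc i < l \<Longrightarrow> E (p ! i) (p ! Suc i)"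
    using p by (auto simp: is_path_def l_def)
  have l: "l > 0" "p ! (l - 1) = q k"
    using ne(1) k by (auto simp: l_def last_conv_nth)
  have new: "q (Suc k + m) \<noteq> p ! n" if "n < l" for n m
  proof
    assume "q (Suc k + m) = p ! n"
    moreover have "p ! n \<in> set p"
      using that by (simp add: l_def)
    ultimately have "q (Suc k + m) \<in> set p \<inter> range q"
      using rangeI[of q "Suc k + m"] by simp
    then have "q (Suc k + m) = q k"
      using int k by simp
    then show False
      using rq(1) by (simp add: inj_eq)
  qed
  have neq: "q' i \<noteq> q' j" if "i < j" for i j
  proof (cases "j < l")
    case True
    then show ?thesis
      using that ne(2) by (simp add: q'_def nth_eq_iff_index_eq l_def)
  next
    case False
    have "p ! i \<noteq> q (Suc k + (j - l))" if "i < l"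
      using new[OF that, of "j - l"] by (rule not_sym)
    then show ?thesis
      using False \<open>i < j\<close> rq(1) by (auto simp: q'_def inj_eq simp del: add_Suc)
  qed
  have "inj q'"
    by (rule linorder_injI) (rule neq)
  moreover have sub: "range q' \<subseteq> set p \<union> range q"
    by (auto simp: q'_def l_def)
  moreover have "E (q' n) (q' (Suc n))" for n
  proof -
    consider "Suc n < l" | "Suc n = l" | "n \<ge> l"
      by linarith
    then show ?thesis
    proof cases
      case 2
      then have "n = l - 1"
        by simp
      then show ?thesis
        using 2 l rq(3)[of k] by (simp add: q'_def)
    next
      case 3
      then have "Suc k + (Suc n - l) = Suc (Suc k + (n - l))"
        by simp
      then show ?thesis
        using 3 rq(3) by (simp add: q'_def del: add_Suc)
    qed (use ne(4) in \<open>simp add: q'_def\<close>)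
  qed
  ultimately have ray: "is_ray V E q'"
    using ne(3) rq(2) unfolding is_ray_def by blast
  obtain b where b: "is_ray V E b" "\<epsilon> = {s. equiv_rays V E b s}"
    using is_end unfolding is_end_def by blast
  \<comment> \<open>Enlarging \<open>S\<close> by the vertices of \<open>q\<close> up to
    \<open>q k\<close> forces a path from \<open>b\<close> to \<open>q\<close> to end in the tail
    that \<open>q'\<close> shares.\<close>
  have "\<not> separates V E S b q'" if "finite S" for S
  proof -
    have "finite (S \<union> q ` {..k})"
      using that by simp
    then have "\<not> separates V E (S \<union> q ` {..k}) b q"
      using q unfolding b(2) equiv_rays_def mem_Collect_eq by metis
    then obtain s where s: "is_path V E s" "hd s \<in> range b" "last s \<in> range q"
      "set s \<inter> (S \<union> q ` {..k}) = {}"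
      unfolding separates_def by blast
    obtain m where m: "last s = q m"
      using s(3) by blast
    have "last s \<in> set s"
      using s(1) by (simp add: is_path_iff)
    then have "\<not> m \<le> k"
      using s(4) m by auto
    then obtain d where "m = Suc k + d"
      by (metis not_less_eq_eq nat_le_iff_add)
    then have "last s = q' (l + d)"
      using m by (simp add: q'_def)
    then show ?thesis
      using s unfolding separates_def by blast
  qed
  then have "q' \<in> \<epsilon>"
    unfolding b(2) equiv_rays_def using b(1) ray by blast
  moreover have "hd p = q' 0"
    using ne(1) l(1) by (simp add: q'_def hd_conv_nth)
  ultimately show ?thesis
    using sub by (intro that[of q']) auto
qed

text \<open>A path from \<open>q\<close> to \<open>r\<close> outside \<open>S\<close> is pruned to
  one from \<open>q\<close> to \<open>X\<close>, and its last vertex \<open>a\<close> is split off.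
  Something remains because \<open>q\<close> avoids \<open>X\<close>. Varying \<open>S\<close>
  yields new points of attachment.\<close>

lemma attachment:
  assumes "q \<in> \<epsilon>" "r \<in> \<epsilon>" "range r \<subseteq> X" "range q \<inter> X = {}" "finite S"
  obtains p a where "is_path V E p" "set p \<inter> range q = {hd p}" "set p \<inter> X = {}" "set p \<inter> S = {}"
    "E (last p) a" "a \<in> X" "a \<notin> S"
proof -
  obtain x y where xy: "x \<in> range q" "y \<in> range r" "link S x y"
    using end_links[OF assms(1,2,5)] .
  obtain t where t: "is_path V E t" "hd t = x" "last t = y" "set t \<inter> S = {}"
    using xy(3) unfolding link_def by blast
  have "hd t \<in> range q" "last t \<in> X"
    using t(2,3) xy(1,2) assms(3) by auto
  then obtain s where s: "is_path V E s" "set s \<subseteq> set t" "set s \<inter> range q = {hd s}" "set s \<inter> X = {last s}"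
    using path_prune[OF t(1)] by metis
  have "s \<noteq> []"
    using s(1) by (simp add: is_path_iff)
  then obtain p a where sp: "s = p @ [a]"
    by (metis rev_exhaust)
  have "a \<notin> range q"
    using s(4) assms(4) unfolding sp by auto
  then have pne: "p \<noteq> []"
    using s(3) unfolding sp by auto
  have "a \<notin> set p"
    using s(1) unfolding sp by (simp add: is_path_iff)
  show ?thesis
  proof (rule that[of p a])
    show "is_path V E p"
      using s(1) is_path_appendD(1)[of V E p "[a]"] pne sp by simp
    show "E (last p) a"
      using s(1) pne unfolding sp by (simp add: is_path_iff successively_append_iff)
    show "set p \<inter> range q = {hd p}"
      using s(3) \<open>a \<notin> range q\<close> pne unfolding sp by auto
    show "set p \<inter> X = {}" "a \<in> X"
      using s(4) \<open>a \<notin> set p\<close> unfolding sp by auto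
    show "set p \<inter> S = {}" "a \<notin> S"
      using s(2) t(4) unfolding sp by auto
  qed
qed

section \<open>Adjacency to the end, and fans\<close>

text \<open>A ray avoiding \<open>Z\<close> lies in one component of the graph minus
  \<open>Z\<close>, so \<open>q 0\<close> can represent it. The vertex \<open>u\<close> itself may
  belong to \<open>Z\<close>.\<close>

definition end_adjacent :: "'a set \<Rightarrow> 'a \<Rightarrow> bool" where
  "end_adjacent Z u \<longleftrightarrow> (\<exists>q\<in>\<epsilon>. range q \<inter> Z = {} \<and> (\<exists>y. link Z (q 0) y \<and> E y u))"

text \<open>Asking for neighbours of \<open>a\<close> and \<open>u\<close>, rather than for a path from \<open>a\<close> to \<open>u\<close>, rules out
  the path consisting of a single edge \<open>a u\<close>, which could not be used repeatedly.\<close>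
definition uncountably_linked :: "'a \<Rightarrow> 'a \<Rightarrow> bool" where
  "uncountably_linked a u \<longleftrightarrow>
    (\<forall>Z. countable Z \<longrightarrow> (\<exists>p. is_path V E p \<and> set p \<inter> Z = {} \<and> E a (hd p) \<and> E (last p) u))"

text \<open>The paths may share their endpoints, even all of them. Off the two rays the family is
  only finite at each vertex, which is the form in which countably many fans can be thinned out
  together.\<close>

definition fan :: "(nat \<Rightarrow> 'a) \<Rightarrow> (nat \<Rightarrow> 'a) \<Rightarrow> 'a list set \<Rightarrow> bool" where
  "fan r q P \<longleftrightarrow> q \<in> \<epsilon> \<and> infinite P \<and> countable P \<and>
    (\<forall>p\<in>P. is_path V E p \<and> set p \<inter> range q = {hd p} \<and> set p \<inter> range r = {last p}) \<and>
    (\<forall>x. x \<notin> range q \<union> range r \<longrightarrow> finite {p \<in> P. x \<in> set p})"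

text \<open>Reduces the construction of a fan to finding a single path that is new off the two rays
  with respect to a finite set \<open>S\<close>.\<close>

lemma fanI:
  assumes "q \<in> \<epsilon>"
    and "\<And>S. finite S \<Longrightarrow> \<exists>p. is_path V E p \<and> set p \<inter> range q = {hd p} \<and> set p \<inter> range r = {last p} \<and>
      set p \<inter> Z \<subseteq> Z0 \<and> set p \<inter> S \<subseteq> range q \<union> range r \<and> \<not> set p \<subseteq> S"
  shows "\<exists>P. fan r q P \<and> (\<forall>p\<in>P. set p \<inter> Z \<subseteq> Z0)"
proof (rule infinite_family_disjoint_outside)
  show "\<exists>p. (is_path V E p \<and> set p \<inter> range q = {hd p} \<and> set p \<inter> range r = {last p} \<and> set p \<inter> Z \<subseteq> Z0) \<and>
      set p \<inter> S \<subseteq> range q \<union> range r \<and> \<not> set p \<subseteq> S" if "finite S" for S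
    using assms(2)[OF that] by (simp only: conj_assoc)
next
  fix P :: "'a list set"
  assume "infinite P" "countable P"
    "\<And>p. p \<in> P \<Longrightarrow> is_path V E p \<and> set p \<inter> range q = {hd p} \<and> set p \<inter> range r = {last p} \<and> set p \<inter> Z \<subseteq> Z0"
    "\<And>x. x \<notin> range q \<union> range r \<Longrightarrow> finite {p \<in> P. x \<in> set p}"
  with assms(1) show ?thesis
    unfolding fan_def by (intro exI[of _ P]) simp
qed

text \<open>A path from \<open>u\<close> through its neighbour \<open>y\<close> to \<open>q\<close>,
  pruned to meet \<open>q\<close> only at its end, prolongs \<open>q\<close> to a ray of the end
  through \<open>u\<close>.\<close>

lemma ray_through_end_adjacent:
  assumes "end_adjacent {u} u"
  obtains r where "r \<in> \<epsilon>" "u \<in> range r"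
proof -
  obtain q y where q: "q \<in> \<epsilon>" "range q \<inter> {u} = {}" "link {u} (q 0) y" "E y u"
    using assms unfolding end_adjacent_def by blast
  obtain p where p: "is_path V E p" "hd p = y" "last p = q 0" "set p \<inter> {u} = {}"
    using link_sym[OF q(3)] unfolding link_def by blast
  have "p \<noteq> []"
    using p(1) by (simp add: is_path_iff)
  have "is_path V E (u # p)"
    using p edge_sym[OF q(4)] edge_in_V[OF q(4)] by (simp add: is_path_iff successively_Cons)
  moreover have "hd (u # p) \<in> {u}" "last (u # p) \<in> range q"
    using p(3) \<open>p \<noteq> []\<close> by auto
  ultimately obtain s where s: "is_path V E s" "set s \<inter> {u} = {hd s}" "set s \<inter> range q = {last s}"
    using path_prune by metis
  obtain r where "r \<in> \<epsilon>" "hd s \<in> range r"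
    using end_extend[OF s(1) q(1) s(3)] by blast
  with s(2) show ?thesis
    by (intro that[of r]) auto
qed

end

section \<open>Ends with a ray outside every countable set\<close>

locale thick_end = graph_end +
  assumes avoiding_ray: "countable Z \<Longrightarrow> \<exists>q\<in>\<epsilon>. range q \<inter> Z = {}"
begin

text \<open>Otherwise close a ray of the end under the countable sets witnessing the failure at each
  vertex: a ray outside this closure would be adjacent to none of its vertices.\<close>
lemma ex_end_adjacent: "\<exists>u. \<forall>Z. countable Z \<longrightarrow> end_adjacent Z u"
proof (rule ccontr)
  assume "\<not> ?thesis"
  then obtain f where f: "\<And>u. countable (f u)" "\<And>u. \<not> end_adjacent (f u) u"
    by metis
  obtain r where r: "r \<in> \<epsilon>"
    using avoiding_ray[of "{}"] by auto
  obtain X where X: "countable X" "range r \<subseteq> X" "\<And>x. x \<in> X \<Longrightarrow> f x \<subseteq> X"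
    using countable_closure[of f "range r"] f(1) by auto
  obtain q where q: "q \<in> \<epsilon>" "range q \<inter> X = {}"
    using avoiding_ray[OF X(1)] by blast
  obtain p a where p: "is_path V E p" "set p \<inter> range q = {hd p}" "set p \<inter> X = {}" "E (last p) a" "a \<in> X"
    using attachment[OF q(1) r X(2) q(2) finite.emptyI] by metis
  have fX: "f a \<subseteq> X"
    using X(3) p(5) .
  obtain i where i: "hd p = q i"
    using p(2) by blast
  have "link X (q 0) (q i)"
    using end_is_ray[OF q(1)] q(2) by (intro link_ray) auto
  moreover have "link X (q i) (last p)"
    using linkI[OF p(1,3)] i by simp
  ultimately have "link (f a) (q 0) (last p)"
    using link_trans link_mono fX by metis
  moreover have "range q \<inter> f a = {}"
    using q(2) fX by blast
  ultimately show False
    using f(2)[of a] q(1) p(4) unfolding end_adjacent_def by blast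
qed

text \<open>The set \<open>Z0\<close> is fixed before \<open>Z\<close>: however large the countable
  set to be avoided grows, the paths return to it only within the same \<open>Z0\<close>.\<close>

definition ample :: "(nat \<Rightarrow> 'a) \<Rightarrow> 'a set \<Rightarrow> bool" where
  "ample r Z0 \<longleftrightarrow> r \<in> \<epsilon> \<and> countable Z0 \<and> range r \<subseteq> Z0 \<and>
    (\<forall>Z. countable Z \<longrightarrow> (\<exists>q P. fan r q P \<and> range q \<inter> Z = {} \<and> (\<forall>p\<in>P. set p \<inter> Z \<subseteq> Z0)))"

text \<open>All paths of the fan run from \<open>v\<close> to \<open>u\<close>. Their inner parts
  can avoid \<open>Z\<close>, both rays and \<open>S\<close>, since these are countable together;
  only the endpoint \<open>u\<close>, which is on \<open>r\<close>, may lie in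
  \<open>Z\<close>.\<close>

lemma ample_direct:
  assumes r: "r \<in> \<epsilon>" "u \<in> range r"
    and rays: "\<And>Z. countable Z \<Longrightarrow> \<exists>q\<in>\<epsilon>. range q \<inter> Z = {} \<and> (\<exists>v\<in>range q. uncountably_linked v u)"
  shows "ample r (range r)"
  unfolding ample_def
proof (intro conjI allI impI)
  fix Z :: "'a set"
  assume Z: "countable Z"
  obtain q v where q: "q \<in> \<epsilon>" "range q \<inter> (Z \<union> range r) = {}" "v \<in> range q" "uncountably_linked v u"
    using rays[of "Z \<union> range r"] Z by auto
  have "\<exists>P. fan r q P \<and> (\<forall>p\<in>P. set p \<inter> Z \<subseteq> range r)"
  proof (rule fanI[OF q(1)])
    fix S :: "'a set"
    assume "finite S"
    then have "countable (Z \<union> range r \<union> range q \<union> S)"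
      using Z by (simp add: countable_finite)
    then obtain p where p: "is_path V E p" "set p \<inter> (Z \<union> range r \<union> range q \<union> S) = {}" "E v (hd p)" "E (last p) u"
      using q(4) unfolding uncountably_linked_def by blast
    have ne: "p \<noteq> []"
      using p(1) by (simp add: is_path_iff)
    have uv: "u \<notin> range q" "v \<notin> range r" "u \<noteq> v" "v \<notin> Z"
      using q(2,3) r(2) by auto
    have "is_path V E (v # p @ [u])"
      using p uv q(3) r(2) edge_in_V[OF p(3)] edge_in_V[OF p(4)] ne
      by (auto simp: is_path_iff successively_Cons successively_append_iff)
    moreover have "set (v # p @ [u]) \<inter> range q = {hd (v # p @ [u])}"
      "set (v # p @ [u]) \<inter> range r = {last (v # p @ [u])}"
      "set (v # p @ [u]) \<inter> Z \<subseteq> range r" "set (v # p @ [u]) \<inter> S \<subseteq> range q \<union> range r"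
      using p(2) uv q(3) r(2) by auto
    moreover have "hd p \<in> set p"
      using ne by simp
    then have "\<not> set (v # p @ [u]) \<subseteq> S"
      using p(2) by auto
    ultimately show "\<exists>p. is_path V E p \<and> set p \<inter> range q = {hd p} \<and> set p \<inter> range r = {last p} \<and>
        set p \<inter> Z \<subseteq> range r \<and> set p \<inter> S \<subseteq> range q \<union> range r \<and> \<not> set p \<subseteq> S"
      by blast
  qed
  then show "\<exists>q P. fan r q P \<and> range q \<inter> Z = {} \<and> (\<forall>p\<in>P. set p \<inter> Z \<subseteq> range r)"
    using q(2) by blast
qed (use r in auto)

text \<open>A ray \<open>q\<close> outside a suitably closed countable set \<open>X\<close> attaches to infinitely many vertices \<open>a\<close>
  of \<open>X\<close>. Since \<open>q\<close> also attaches to \<open>u\<close>, closedness makes \<open>a\<close> uncountably linked to \<open>u\<close>; and \<open>a\<close>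
  lies in \<open>Z1\<close>, as otherwise prolonging \<open>q\<close> to \<open>a\<close> contradicts the choice of \<open>Z1\<close>.\<close>
lemma ample_indirect:
  assumes r: "r \<in> \<epsilon>" "u \<in> range r"
    and u: "\<And>Z. countable Z \<Longrightarrow> end_adjacent Z u"
    and Z1: "countable Z1" "\<And>q v. q \<in> \<epsilon> \<Longrightarrow> range q \<inter> Z1 = {} \<Longrightarrow> v \<in> range q \<Longrightarrow> \<not> uncountably_linked v u"
  shows "ample r (Z1 \<union> range r)"
  unfolding ample_def
proof (intro conjI allI impI)
  fix Z :: "'a set"
  assume Z: "countable Z"
  \<comment> \<open>If \<open>a\<close> is not uncountably linked to \<open>u\<close>, then
    \<open>f a\<close> is a countable set meeting every path from a neighbour of \<open>a\<close> to
    a neighbour of \<open>u\<close>.\<close>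
  have "\<forall>a. \<exists>W. countable W \<and> (uncountably_linked a u \<or>
      \<not> (\<exists>p. is_path V E p \<and> set p \<inter> W = {} \<and> E a (hd p) \<and> E (last p) u))"
    unfolding uncountably_linked_def by blast
  then obtain f where f: "\<And>a. countable (f a)"
    "\<And>a p. \<not> uncountably_linked a u \<Longrightarrow> is_path V E p \<Longrightarrow> set p \<inter> f a = {} \<Longrightarrow> E a (hd p) \<Longrightarrow> E (last p) u \<Longrightarrow> False"
    by metis
  obtain X where X: "countable X" "Z \<union> Z1 \<union> range r \<subseteq> X" "\<And>x. x \<in> X \<Longrightarrow> f x \<subseteq> X"
    using countable_closure[of f "Z \<union> Z1 \<union> range r"] f(1) Z Z1(1) by auto
  obtain q y where q: "q \<in> \<epsilon>" "range q \<inter> X = {}" "link X (q 0) y" "E y u"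
    using u[OF X(1)] unfolding end_adjacent_def by blast
  have uX: "u \<in> X"
    using r(2) X(2) by blast
  then have uq: "u \<notin> range q"
    using q(2) by blast
  have "\<exists>P. fan r q P \<and> (\<forall>p\<in>P. set p \<inter> Z \<subseteq> Z1 \<union> range r)"
  proof (rule fanI[OF q(1)])
    fix S :: "'a set"
    assume S: "finite S"
    obtain p a where p: "is_path V E p" "set p \<inter> range q = {hd p}" "set p \<inter> X = {}" "set p \<inter> S = {}"
      and a: "E (last p) a" "a \<in> X" "a \<notin> S" "a \<noteq> u"
    \<comment> \<open>Putting \<open>u\<close> into the finite set to be avoided ensures
      \<open>a \<noteq> u\<close>, so that a path from \<open>a\<close> on to \<open>u\<close> can
      be appended.\<close>
    proof (rule attachment[OF q(1) r(1), of X "insert u S"])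
      show "range r \<subseteq> X"
        using X(2) by blast
    qed (use q(2) S in auto)
    have ne: "p \<noteq> []"
      using p(1) by (simp add: is_path_iff)
    have ap: "a \<notin> set p" "a \<notin> range q" "a \<in> V"
      using p(3) a(2) q(2) edge_in_V[OF a(1)] by auto
    have pa: "is_path V E (p @ [a])"
      using p(1) ap a(1) ne by (simp add: is_path_iff successively_append_iff)
    have hdp: "hd p \<in> set p" "hd p \<in> range q"
      using p(2) by auto
    obtain i where i: "hd p = q i"
      using hdp(2) by blast
    have linked: "uncountably_linked a u"
    proof (rule ccontr)
      assume not: "\<not> uncountably_linked a u"
      \<comment> \<open>Going back along \<open>p\<close>, then along \<open>q\<close>, then on to
        \<open>y\<close> stays outside \<open>X\<close> and so outside \<open>f a\<close>, but leads
        from a neighbour of \<open>a\<close> to a neighbour of \<open>u\<close>.\<close>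
      have "link X (last p) (q i)"
        using linkI[OF p(1,3)] i link_sym by simp
      moreover have "link X (q i) (q 0)"
        using end_is_ray[OF q(1)] q(2) by (intro link_ray) auto
      ultimately have "link X (last p) y"
        using link_trans[OF link_trans[OF _ _] q(3)] by blast
      then obtain s where s: "is_path V E s" "hd s = last p" "last s = y" "set s \<inter> X = {}"
        unfolding link_def by blast
      then have "set s \<inter> f a = {}"
        using X(3)[OF a(2)] by blast
      then show False
        using f(2)[OF not s(1)] s(2,3) q(4) edge_sym[OF a(1)] by simp
    qed
    have "a \<in> Z1"
    proof (rule ccontr)
      assume "a \<notin> Z1"
      have "is_path V E (rev (p @ [a]))"
        using is_path_rev[OF graph pa] .
      moreover have "set (rev (p @ [a])) \<inter> range q = {last (rev (p @ [a]))}"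
        using p(2) ap(2) ne by (simp add: last_rev)
      ultimately obtain q' where q': "q' \<in> \<epsilon>" "hd (rev (p @ [a])) \<in> range q'"
        "range q' \<subseteq> set (rev (p @ [a])) \<union> range q"
        using end_extend q(1) by metis
      have "insert a (set p \<union> range q) \<inter> Z1 = {}"
        using p(3) q(2) X(2) \<open>a \<notin> Z1\<close> by blast
      moreover have "range q' \<subseteq> insert a (set p \<union> range q)"
        using q'(3) by simp
      ultimately have "range q' \<inter> Z1 = {}"
        by blast
      then show False
        using Z1(2)[OF q'(1)] q'(2) linked by simp
    qed
    show "\<exists>p. is_path V E p \<and> set p \<inter> range q = {hd p} \<and> set p \<inter> range r = {last p} \<and>
        set p \<inter> Z \<subseteq> Z1 \<union> range r \<and> set p \<inter> S \<subseteq> range q \<union> range r \<and> \<not> set p \<subseteq> S"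
    \<comment> \<open>A point of attachment on \<open>r\<close> already ends the path. Otherwise a
      fresh path leads from \<open>a\<close> to \<open>u\<close>; now \<open>a\<close> is an inner
      vertex that may lie in \<open>Z\<close>, which is allowed because it is in
      \<open>Z1\<close>.\<close>
    proof (cases "a \<in> range r")
      case True
      show ?thesis
      proof (intro exI[of _ "p @ [a]"] conjI)
        show "set (p @ [a]) \<inter> range q = {hd (p @ [a])}"
          using p(2) ap(2) ne by simp
        show "set (p @ [a]) \<inter> range r = {last (p @ [a])}"
          using True p(3) X(2) by auto
        show "set (p @ [a]) \<inter> Z \<subseteq> Z1 \<union> range r" "set (p @ [a]) \<inter> S \<subseteq> range q \<union> range r"
          using True p(3,4) X(2) by auto
        show "\<not> set (p @ [a]) \<subseteq> S"
          using hdp(1) p(4) by auto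
      qed (rule pa)
    next
      case False
      have "countable (X \<union> range q \<union> set p \<union> S)"
        using X(1) S by (simp add: countable_finite)
      then obtain w where w: "is_path V E w" "set w \<inter> (X \<union> range q \<union> set p \<union> S) = {}"
        "E a (hd w)" "E (last w) u"
        using linked unfolding uncountably_linked_def by blast
      have wne: "w \<noteq> []"
        using w(1) by (simp add: is_path_iff)
      have "is_path V E (w @ [u])"
        using w uX wne edge_in_V[OF w(4)] by (auto simp: is_path_iff successively_append_iff)
      then have path: "is_path V E ((p @ [a]) @ (w @ [u]))"
        using w p(3) uX a(2,4) wne by (intro is_path_append[OF pa]) auto
      show ?thesis
      proof (intro exI[of _ "(p @ [a]) @ (w @ [u])"] conjI)
        show "set ((p @ [a]) @ (w @ [u])) \<inter> range q = {hd ((p @ [a]) @ (w @ [u]))}"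
          using p(2) ap(2) ne w(2) uq by auto
        show "set ((p @ [a]) @ (w @ [u])) \<inter> range r = {last ((p @ [a]) @ (w @ [u]))}"
          using False p(3) X(2) w(2) r(2) by auto
        show "set ((p @ [a]) @ (w @ [u])) \<inter> Z \<subseteq> Z1 \<union> range r"
          using p(3) X(2) w(2) r(2) \<open>a \<in> Z1\<close> by auto
        show "set ((p @ [a]) @ (w @ [u])) \<inter> S \<subseteq> range q \<union> range r"
          using p(4) a(3) w(2) r(2) by auto
        show "\<not> set ((p @ [a]) @ (w @ [u])) \<subseteq> S"
          using hdp(1) p(4) by auto
      qed (rule path)
    qed
  qed
  then show "\<exists>q P. fan r q P \<and> range q \<inter> Z = {} \<and> (\<forall>p\<in>P. set p \<inter> Z \<subseteq> Z1 \<union> range r)"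
    using q(1,2) X(2) by blast
qed (use r Z1 in auto)

text \<open>If the condition on rays in \<open>ample_direct\<close> fails, a countable set at which
  it fails is the \<open>Z1\<close> of \<open>ample_indirect\<close>.\<close>

lemma ex_ample: "\<exists>r Z0. ample r Z0"
proof -
  obtain u where u: "\<And>Z. countable Z \<Longrightarrow> end_adjacent Z u"
    using ex_end_adjacent by blast
  obtain r where r: "r \<in> \<epsilon>" "u \<in> range r"
    using ray_through_end_adjacent[OF u[of "{u}"]] by auto
  show ?thesis
  proof (cases "\<forall>Z. countable Z \<longrightarrow> (\<exists>q\<in>\<epsilon>. range q \<inter> Z = {} \<and> (\<exists>v\<in>range q. uncountably_linked v u))")
    case True
    then have "ample r (range r)"
      by (intro ample_direct[OF r]) blast
    then show ?thesis
      by blast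
  next
    case False
    then obtain Z1 where "countable Z1"
      "\<not> (\<exists>q\<in>\<epsilon>. range q \<inter> Z1 = {} \<and> (\<exists>v\<in>range q. uncountably_linked v u))"
      by metis
    then have "ample r (Z1 \<union> range r)"
      by (intro ample_indirect[OF r u]) metis+
    then show ?thesis
      by blast
  qed
qed

section \<open>Uncountably many fans and their star\<close>

text \<open>Paths of the two fans may still cross each other; such crossings are removed only when
  countably many fans are thinned out.\<close>

definition separate :: "(nat \<Rightarrow> 'a) \<times> 'a list set \<Rightarrow> (nat \<Rightarrow> 'a) \<times> 'a list set \<Rightarrow> bool" where
  "separate x y \<longleftrightarrow> range (fst x) \<inter> range (fst y) = {} \<and>
    (\<forall>p\<in>snd y. set p \<inter> range (fst x) = {}) \<and> (\<forall>p\<in>snd x. set p \<inter> range (fst y) = {})"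

lemma separate_sym: "separate x y \<Longrightarrow> separate y x"
  unfolding separate_def by blast

text \<open>A maximal family of pairwise separate fans cannot be countable, because the fan avoiding
  all of its vertices could be added to it.\<close>
lemma uncountable_separate_fans:
  assumes "ample r Z0"
  obtains M where "uncountable M" "\<And>x. x \<in> M \<Longrightarrow> fan r (fst x) (snd x)"
    "\<And>x. x \<in> M \<Longrightarrow> range (fst x) \<inter> Z0 = {}" "\<And>x y. x \<in> M \<Longrightarrow> y \<in> M \<Longrightarrow> x \<noteq> y \<Longrightarrow> separate x y"
proof -
  \<comment> \<open>Keeping the rays off \<open>Z0\<close> matters for enlarging a family: the paths
    of a new fan may return to \<open>Z0\<close>, and must not hit an old ray there.\<close>
  define \<M> where "\<M> = {M. (\<forall>x\<in>M. fan r (fst x) (snd x) \<and> range (fst x) \<inter> Z0 = {}) \<and>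
    (\<forall>x\<in>M. \<forall>y\<in>M. x \<noteq> y \<longrightarrow> separate x y)}"
  have sep_\<M>: "separate x y" if "A \<in> \<M>" "x \<in> A" "y \<in> A" "x \<noteq> y" for A x y
    using that unfolding \<M>_def by simp
  have "\<exists>M\<in>\<M>. \<forall>X\<in>\<M>. M \<subseteq> X \<longrightarrow> X = M"
  proof (rule subset_Zorn')
    fix C
    assume C: "subset.chain \<M> C"
    have sep: "separate x y" if "x \<in> A" "y \<in> B" "A \<in> C" "B \<in> C" "x \<noteq> y" for x y A B
    proof -
      have "A \<subseteq> B \<or> B \<subseteq> A"
        using C that(3,4) unfolding subset_chain_def by blast
      moreover have "A \<in> \<M>" "B \<in> \<M>"
        using C that(3,4) unfolding subset_chain_def by blast+
      ultimately show ?thesis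
        using that(1,2,5) sep_\<M>[of A x y] sep_\<M>[of B x y] by blast
    qed
    have fans: "fan r (fst x) (snd x) \<and> range (fst x) \<inter> Z0 = {}" if "x \<in> A" "A \<in> C" for x A
    proof -
      have "A \<in> \<M>"
        using C that(2) unfolding subset_chain_def by blast
      then show ?thesis
        using that(1) unfolding \<M>_def by simp
    qed
    show "\<Union>C \<in> \<M>"
      unfolding \<M>_def
    proof (intro CollectI conjI[of "\<forall>x\<in>\<Union>C. _ x"] ballI impI; elim UnionE)
      show "fan r (fst x) (snd x) \<and> range (fst x) \<inter> Z0 = {}" if "x \<in> A" "A \<in> C" for x A
        using fans[OF that] .
      show "separate x y" if "x \<in> A" "y \<in> B" "A \<in> C" "B \<in> C" "x \<noteq> y" for x y A B
        using sep[OF that] .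
    qed
  qed
  then obtain M where M: "M \<in> \<M>" "\<And>X. X \<in> \<M> \<Longrightarrow> M \<subseteq> X \<Longrightarrow> X = M"
    by metis
  then have fans: "\<And>x. x \<in> M \<Longrightarrow> fan r (fst x) (snd x)" "\<And>x. x \<in> M \<Longrightarrow> range (fst x) \<inter> Z0 = {}"
    and sep: "\<And>x y. x \<in> M \<Longrightarrow> y \<in> M \<Longrightarrow> x \<noteq> y \<Longrightarrow> separate x y"
    unfolding \<M>_def by simp_all
  have "uncountable M"
  proof
    assume "countable M"
    define Z where "Z = Z0 \<union> (\<Union>x\<in>M. range (fst x) \<union> (\<Union>p\<in>snd x. set p))"
    have "countable (snd x)" if "x \<in> M" for x
      using fans(1)[OF that] unfolding fan_def by simp
    then have "countable Z"
      using \<open>countable M\<close> assms unfolding Z_def ample_def by (auto simp: countable_finite)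
    then obtain q P where q: "fan r q P" "range q \<inter> Z = {}" "\<And>p. p \<in> P \<Longrightarrow> set p \<inter> Z \<subseteq> Z0"
      using assms unfolding ample_def by metis
    have new: "separate (q, P) x" if "x \<in> M" for x
    proof -
      have "range (fst x) \<subseteq> Z" "\<And>p. p \<in> snd x \<Longrightarrow> set p \<subseteq> Z"
        using that unfolding Z_def by blast+
      moreover have "set p \<inter> range (fst x) = {}" if "p \<in> P" for p
        using q(3)[OF that] fans(2)[OF \<open>x \<in> M\<close>] calculation(1) by blast
      ultimately show ?thesis
        using q(2) unfolding separate_def fst_conv snd_conv by blast
    qed
    have "range q \<inter> Z0 = {}"
      using q(2) unfolding Z_def by blast
    then have "insert (q, P) M \<in> \<M>"
      using q(1) fans sep new separate_sym[OF new] unfolding \<M>_def by simp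
    then have "(q, P) \<in> M"
      using M(2) by blast
    then have "range q \<subseteq> Z"
      unfolding Z_def by force
    then show False
      using q(2) by blast
  qed
  with fans sep show ?thesis
    by (intro that)
qed

text \<open>Separateness of the fans makes all their paths internally disjoint from all the rays at
  once. Independence is obtained afresh for each countable subfamily by thinning, which leaves
  infinitely many paths from each of its rays to the centre \<open>r\<close>.\<close>

lemma star_of_fans:
  assumes "ample r Z0"
  obtains \<R> P where "r \<in> \<R>" "\<R> \<subseteq> \<epsilon>" "disjoint_rays V E \<R>" "uncountable \<R>"
    "R_family V E \<R> P" "R_internally_disjoint \<R> P"
    "\<forall>\<R>'. \<R>' \<subseteq> \<R> \<and> countable \<R>' \<longrightarrow> (\<exists>P''. P'' \<subseteq> P \<and> countable P'' \<and> independent P'' \<and>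
      R_family V E (insert r \<R>') P'' \<and> ray_graph_connected (insert r \<R>') P'')"
proof -
  have r: "r \<in> \<epsilon>" "range r \<subseteq> Z0"
    using assms unfolding ample_def by auto
  obtain M where M: "uncountable M" "\<And>x. x \<in> M \<Longrightarrow> fan r (fst x) (snd x)"
    "\<And>x. x \<in> M \<Longrightarrow> range (fst x) \<inter> Z0 = {}" "\<And>x y. x \<in> M \<Longrightarrow> y \<in> M \<Longrightarrow> x \<noteq> y \<Longrightarrow> separate x y"
    using uncountable_separate_fans[OF assms] by metis
  have rM: "range (fst x) \<inter> range r = {}" if "x \<in> M" for x
    using M(3)[OF that] r(2) by blast
  \<comment> \<open>Different fans have different rays, so uncountably many fans give uncountably
    many rays.\<close>
  have inj: "inj_on fst M"
  proof (rule inj_onI, rule ccontr)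
    fix x y
    assume "x \<in> M" "y \<in> M" "fst x = fst y" "x \<noteq> y"
    then have "range (fst x) \<inter> range (fst x) = {}"
      using M(4)[of x y] unfolding separate_def by simp
    then show False
      by simp
  qed
  define \<R> where "\<R> = insert r (fst ` M)"
  define P where "P = \<Union>(snd ` M)"
  have path: "is_path V E p" "set p \<inter> range (fst x) = {hd p}" "set p \<inter> range r = {last p}"
    if "x \<in> M" "p \<in> snd x" for x p
    using M(2)[OF that(1)] that(2) unfolding fan_def by auto
  have internal: "set p \<inter> range s \<subseteq> endpoints p" if ps: "p \<in> P" "s \<in> \<R>" for p s
  proof -
    obtain x where x: "x \<in> M" "p \<in> snd x"
      using ps(1) unfolding P_def by blast
    consider "s = r" | "s = fst x" | y where "y \<in> M" "y \<noteq> x" "s = fst y"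
      using ps(2) unfolding \<R>_def by blast
    then show ?thesis
    proof cases
      case 3
      then have "set p \<inter> range s = {}"
        using M(4)[of y x] x unfolding separate_def by blast
      then show ?thesis
        by simp
    qed (use path[OF x] in \<open>auto simp: endpoints_def\<close>)
  qed
  show ?thesis
  proof (rule that[of \<R> P])
    show "r \<in> \<R>"
      unfolding \<R>_def by simp
    show sub: "\<R> \<subseteq> \<epsilon>"
      using r(1) M(2) unfolding \<R>_def fan_def by blast
    have rMM: "range (fst x) \<inter> range (fst y) = {}" if "x \<in> M" "y \<in> M" "fst x \<noteq> fst y" for x y
      using M(4)[of x y] that unfolding separate_def by blast
    have "range s \<inter> range t = {}" if "s \<in> \<R>" "t \<in> \<R>" "s \<noteq> t" for s t
      using that unfolding \<R>_def
      by (elim insertE imageE) (simp_all add: rM rMM Int_commute[of "range r"])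
    then show "disjoint_rays V E \<R>"
      unfolding disjoint_rays_def using sub end_is_ray by blast
    have "uncountable (fst ` M)"
      using M(1) inj countable_image_inj_on by blast
    then show "uncountable \<R>"
      unfolding \<R>_def by simp
    show "R_family V E \<R> P"
      unfolding R_family_def
    proof
      fix p
      assume "p \<in> P"
      then obtain x where x: "x \<in> M" "p \<in> snd x"
        unfolding P_def by blast
      have "hd p \<in> range (fst x)" "last p \<in> range r"
        using path[OF x] by blast+
      then show "is_path V E p \<and> (\<exists>r\<in>\<R>. hd p \<in> range r) \<and> (\<exists>r\<in>\<R>. last p \<in> range r)"
        using path(1)[OF x] x(1) unfolding \<R>_def by blast
    qed
    show "R_internally_disjoint \<R> P"
      unfolding R_internally_disjoint_def using internal by blast
  next
    show "\<forall>\<R>'. \<R>' \<subseteq> \<R> \<and> countable \<R>' \<longrightarrow> (\<exists>P''. P'' \<subseteq> P \<and> countable P'' \<and> independent P'' \<and>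
      R_family V E (insert r \<R>') P'' \<and> ray_graph_connected (insert r \<R>') P'')"
    proof (intro allI impI, elim conjE)
      fix \<R>'
      assume \<R>': "\<R>' \<subseteq> \<R>" "countable \<R>'"
      define M' where "M' = {x \<in> M. fst x \<in> \<R>'}"
      have "inj_on fst M'" "fst ` M' \<subseteq> \<R>'"
        using inj unfolding M'_def by (auto simp: inj_on_def)
      then have "countable M'"
        using \<R>'(2) countable_image_inj_on countable_subset by metis
      \<comment> \<open>Overlaps on any ray of \<open>\<R>\<close> may be tolerated: by
        \<open>internal\<close>, a vertex of a path that lies on such a ray is an endpoint of the
        path.\<close>
      define B where "B = (\<Union>s\<in>\<R>. range s)"
      have inf: "infinite P" if "P \<in> snd ` M'" for P
        using that M(2) unfolding M'_def fan_def by blast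
      have fin: "finite {p \<in> P. x \<in> set p}" if P: "P \<in> snd ` M'" "x \<notin> B" for P x
      proof -
        obtain z where z: "z \<in> M" "P = snd z"
          using P(1) unfolding M'_def by blast
        then have "x \<notin> range (fst z) \<union> range r"
          using P(2) unfolding B_def \<R>_def by blast
        then show ?thesis
          using M(2)[OF z(1)] unfolding z(2) fan_def by blast
      qed
      have "\<exists>Q. Q \<subseteq> \<Union>(snd ` M') \<and> countable Q \<and> (\<forall>P\<in>snd ` M'. infinite (P \<inter> Q)) \<and>
        (\<forall>p\<in>Q. \<forall>p'\<in>Q. p \<noteq> p' \<longrightarrow> set p \<inter> set p' \<subseteq> B)"
        using \<open>countable M'\<close> inf fin by (intro infinite_subfamilies_disjoint_outside countable_image)
      then obtain Q where Q: "Q \<subseteq> \<Union>(snd ` M')" "countable Q" "\<forall>P\<in>snd ` M'. infinite (P \<inter> Q)"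
        "\<forall>p\<in>Q. \<forall>p'\<in>Q. p \<noteq> p' \<longrightarrow> set p \<inter> set p' \<subseteq> B"
        by (elim exE conjE)
      have QP: "Q \<subseteq> P"
        using Q(1) unfolding P_def M'_def by blast
      have "independent Q"
        unfolding independent_def
      proof (intro ballI impI subsetI)
        fix p p' v
        assume p: "p \<in> Q" "p' \<in> Q" "p \<noteq> p'" and v: "v \<in> set p \<inter> set p'"
        then obtain s where "s \<in> \<R>" "v \<in> range s"
          using Q(4) p unfolding B_def by blast
        then show "v \<in> endpoints p \<inter> endpoints p'"
          using internal[of p s] internal[of p' s] p(1,2) QP v by blast
      qed
      moreover have "R_family V E (insert r \<R>') Q"
        unfolding R_family_def
      proof
        fix p
        assume "p \<in> Q"
        then obtain x where x: "x \<in> M" "p \<in> snd x" "fst x \<in> \<R>'"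
          using Q(1) unfolding M'_def by blast
        have "hd p \<in> range (fst x)" "last p \<in> range r"
          using path[OF x(1,2)] by blast+
        then show "is_path V E p \<and> (\<exists>r\<in>insert r \<R>'. hd p \<in> range r) \<and> (\<exists>r\<in>insert r \<R>'. last p \<in> range r)"
          using path(1)[OF x(1,2)] x(3) by blast
      qed
      moreover have "ray_graph_connected (insert r \<R>') Q"
      proof -
        have adj: "ray_graph_adj (insert r \<R>') Q s r \<and> ray_graph_adj (insert r \<R>') Q r s"
          if s: "s \<in> \<R>'" "s \<noteq> r" for s
        proof -
          obtain x where x: "x \<in> M" "s = fst x"
            using s \<R>'(1) unfolding \<R>_def by blast
          then have "x \<in> M'"
            using s(1) unfolding M'_def by simp
          then have "infinite (snd x \<inter> Q)"
            using Q(3) by blast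
          moreover have "joins p s r" "joins p r s" if "p \<in> snd x" for p
            using path[OF x(1) that] unfolding joins_def x(2) by blast+
          then have "snd x \<inter> Q \<subseteq> {p \<in> Q. joins p s r}" "snd x \<inter> Q \<subseteq> {p \<in> Q. joins p r s}"
            by blast+
          ultimately show ?thesis
            using s unfolding ray_graph_adj_def by (auto dest: finite_subset)
        qed
        then have "(ray_graph_adj (insert r \<R>') Q)\<^sup>*\<^sup>* s r \<and> (ray_graph_adj (insert r \<R>') Q)\<^sup>*\<^sup>* r s"
          if "s \<in> insert r \<R>'" for s
          using that by (cases "s = r") auto
        then show ?thesis
          unfolding ray_graph_connected_def by (meson rtranclp_trans)
      qed
      ultimately show "\<exists>P''. P'' \<subseteq> P \<and> countable P'' \<and> independent P'' \<and>
          R_family V E (insert r \<R>') P'' \<and> ray_graph_connected (insert r \<R>') P''"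
        using QP Q(2) by blast
    qed
  qed
qed

end

section \<open>From the degree to the theorem\<close>

text \<open>Otherwise choosing a vertex of \<open>Z\<close> on every ray would be injective by
  disjointness and embed \<open>\<R>\<close> into \<open>Z\<close>.\<close>

lemma uncountable_disjoint_family_avoids:
  assumes "uncountable \<R>" "countable Z" "disjoint_rays V E \<R>"
  shows "\<exists>q\<in>\<R>. range q \<inter> Z = {}"
proof (rule ccontr)
  assume "\<not> ?thesis"
  then have "\<forall>q\<in>\<R>. \<exists>z. z \<in> range q \<inter> Z"
    by (simp only: ex_in_conv) simp
  then obtain f where f: "\<forall>q\<in>\<R>. f q \<in> range q \<inter> Z"
    by (rule bchoice[elim_format]) (elim exE)
  have "inj_on f \<R>"
  proof (rule inj_onI, rule ccontr)
    fix q q'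
    assume q: "q \<in> \<R>" "q' \<in> \<R>" "f q = f q'" "q \<noteq> q'"
    then have "range q \<inter> range q' = {}"
      using assms(3) unfolding disjoint_rays_def by simp
    moreover have "f q \<in> range q" "f q' \<in> range q'"
      using f q(1,2) by simp_all
    ultimately show False
      using q(3) by (metis disjoint_iff)
  qed
  moreover have "f ` \<R> \<subseteq> Z"
    using f by (intro image_subsetI) simp
  then have "countable (f ` \<R>)"
    using assms(2) by (rule countable_subset)
  ultimately show False
    using assms(1) countable_image_inj_on[of f \<R>] by simp
qed

theorem theorem3:
  fixes V :: "'a set" and E :: "'a \<Rightarrow> 'a \<Rightarrow> bool" and \<epsilon> :: "(nat \<Rightarrow> 'a) set"
  assumes "graph V E"
    and "is_end V E \<epsilon>"
    and "degree_aleph1 V E \<epsilon>"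
  shows "HC_star_aleph1 V E \<epsilon>"
proof -
  have le: "degree_le V E \<epsilon> aleph1" and nle: "\<not> degree_le V E \<epsilon> natLeq"
    using assms(3) unfolding degree_aleph1_def by auto
  \<comment> \<open>Since the supremum exceeds \<open>natLeq\<close>, some single family of disjoint
    rays is already uncountable.\<close>
  obtain \<R>0 where \<R>0: "\<R>0 \<subseteq> \<epsilon>" "disjoint_rays V E \<R>0" "uncountable \<R>0"
    using nle unfolding degree_le_def countable_card_le_natLeq by blast
  interpret thick_end V E \<epsilon>
  proof
    show "\<exists>q\<in>\<epsilon>. range q \<inter> Z = {}" if "countable Z" for Z
      using uncountable_disjoint_family_avoids[OF \<R>0(3) that \<R>0(2)] \<R>0(1) by blast
  qed (use assms in auto)
  obtain r Z0 where ample: "ample r Z0"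
    using ex_ample by blast
  obtain \<R> P where \<R>: "r \<in> \<R>" "\<R> \<subseteq> \<epsilon>" "disjoint_rays V E \<R>" "uncountable \<R>"
    and P: "R_family V E \<R> P" "R_internally_disjoint \<R> P"
    and star: "\<forall>\<R>'. \<R>' \<subseteq> \<R> \<and> countable \<R>' \<longrightarrow> (\<exists>P''. P'' \<subseteq> P \<and> countable P'' \<and> independent P'' \<and>
      R_family V E (insert r \<R>') P'' \<and> ray_graph_connected (insert r \<R>') P'')"
    using star_of_fans[OF ample] .
  \<comment> \<open>An uncountable family has at least the successor cardinal of
    \<open>natLeq\<close> many members; the bound on the degree gives the converse
    inequality.\<close>
  have "(natLeq, card_of \<R>) \<in> ordLess"
    using \<R>(4) unfolding countable_card_le_natLeq
    using not_ordLeq_iff_ordLess[OF natLeq_Well_order card_of_Well_order] by blast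
  then have "(aleph1, card_of \<R>) \<in> ordLeq"
    by (intro cardSuc_least natLeq_Card_order card_of_Card_order)
  moreover have "(card_of \<R>, aleph1) \<in> ordLeq"
    using le \<R>(2,3) unfolding degree_le_def by blast
  ultimately have "(card_of \<R>, aleph1) \<in> ordIso"
    by (simp add: ordIso_iff_ordLeq)
  moreover have "\<exists>\<R>'' P''. \<R>' \<subseteq> \<R>'' \<and> \<R>'' \<subseteq> \<R> \<and> countable \<R>'' \<and>
      P'' \<subseteq> P \<and> countable P'' \<and> independent P'' \<and> R_family V E \<R>'' P'' \<and>
      ray_graph_connected \<R>'' P''" if \<R>': "\<R>' \<subseteq> \<R> \<and> countable \<R>'" for \<R>'
  proof -
    obtain P'' where "P'' \<subseteq> P \<and> countable P'' \<and> independent P'' \<and>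
        R_family V E (insert r \<R>') P'' \<and> ray_graph_connected (insert r \<R>') P''"
      using star[rule_format, OF \<R>'] by (elim exE)
    moreover have "\<R>' \<subseteq> insert r \<R>'" "insert r \<R>' \<subseteq> \<R>" "countable (insert r \<R>')"
      using \<R>' \<R>(1) by auto
    ultimately show ?thesis
      by blast
  qed
  ultimately show ?thesis
    unfolding HC_star_aleph1_def using \<R>(2,3) P by blast
qed

end
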